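(* The coefficients of the $h^\ast$-polynomial of $P_d(\theta_1,\ldots,\theta_d)$ form a unimodal sequence for all positive integers $\theta_1,\ldots,\theta_d$.
   Context: For positive integers $\theta_1,\ldots,\theta_d$, $P_d(\theta_1,\ldots,\theta_d)\subset\mathbb{R}^d$ is the $d$-dimensional lattice polytope $$P_d(\theta_1,\ldots,\theta_d)=\mathrm{conv}\bigl((-\Delta_d)\cup Q_d(\theta_1,\ldots,\theta_d)\bigr),$$ where $\Delta_d=\mathrm{conv}(\mathbf{0},\mathbf{e}_1,\ldots,\mathbf{e}_d)$ is the standard simplex ($\mathbf{e}_i$ the standard basis vectors) and $Q_d(\theta_1,\ldots,\theta_d)=\{\mathbf{x}\in\mathbb{R}^d:0\le x_i\le\theta_i\text{ for all }1\le i\le d\}$. For a $d$-dimensional lattice polytope $P\subset\mathbb{R}^d$ (convex hull of finitely many points of $\mathbb{Z}^d$), the number $|nP\cap\mathbb{Z}^d|$ agrees for all integers $n\ge 0$ with a polynomial $E_P(n)$ of degree $d$ (the Ehrhart polynomial). The numbers $h_0(P),\ldots,h_d(P)$ are defined by $$E_P(n)=h_0(P)\binom{n+d}{d}+h_1(P)\binom{n+d-1}{d}+\cdots+h_d(P)\binom{n}{d},$$ and the $h^\ast$-polynomial of $P$ is $h_0(P)+h_1(P)t+\cdots+h_d(P)t^d$. A sequence $c_0,c_1,\ldots,c_d$ is unimodal if $c_0\le c_1\le\cdots\le c_k\ge\cdots\ge c_d$ for some $0\le k\le d$. *)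

theory Defs
  imports "HOL-Analysis.Analysis" "HOL-Computational_Algebra.Polynomial"
begin

definition standard_simplex :: "(real ^ 'n) set" where
  "standard_simplex = convex hull (insert 0 (range (\<lambda>i. axis i 1)))"

definition lattice_box :: "('n \<Rightarrow> nat) \<Rightarrow> (real ^ 'n) set" where
  "lattice_box \<theta> = {x. \<forall>i. 0 \<le> x $ i \<and> x $ i \<le> real (\<theta> i)}"

definition simplex_box_polytope :: "('n \<Rightarrow> nat) \<Rightarrow> (real ^ 'n) set" where
  "simplex_box_polytope \<theta> = convex hull (uminus ` standard_simplex \<union> lattice_box \<theta>)"

definition integer_lattice :: "(real ^ 'n) set" where
  "integer_lattice = {x. \<forall>i. x $ i \<in> \<int>}"

text \<open>Meant for lattice polytopes, where such a polynomial exists by Ehrhart's theorem. It is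
  unique because its values at all natural numbers are prescribed; that its degree is the
  dimension of the polytope is a consequence and not part of the definition.\<close>

definition ehrhart_poly :: "(real ^ 'n) set \<Rightarrow> real poly" where
  "ehrhart_poly P =
    (THE E. \<forall>n::nat. poly E (real n) = real (card ((\<lambda>x. real n *\<^sub>R x) ` P \<inter> integer_lattice)))"

text \<open>Meant for full-dimensional lattice polytopes: the dimension d is taken to be that of the
  ambient space. The degree bound says that only the coefficients with index at most d are
  involved; these are determined by the values at n = 0, ..., d, as the system is
  triangular. The subtraction of natural numbers is never truncated, since j is at most d.\<close>

definition hstar_poly :: "(real ^ 'n) set \<Rightarrow> real poly" where
  "hstar_poly P =
    (THE H. degree H \<le> CARD('n) \<and>
      (\<forall>n::nat. poly (ehrhart_poly P) (real n) =
        (\<Sum>j\<le>CARD('n). coeff H j * real ((n + CARD('n) - j) choose CARD('n)))))"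

definition unimodal :: "nat \<Rightarrow> (nat \<Rightarrow> real) \<Rightarrow> bool" where
  "unimodal d c \<longleftrightarrow>
    (\<exists>k\<le>d. (\<forall>i<k. c i \<le> c (Suc i)) \<and> (\<forall>i\<in>{k..<d}. c (Suc i) \<le> c i))"

end

theory Submission
  imports Defs "HOL-Computational_Algebra.Polynomial_FPS"
begin

text \<open>
  An integer point x lies in the n-th dilate of the polytope if and only if, for the sum k of its
  negative parts, k \<le> n and x i \<le> (n - k) * \<theta> i for all i (\<open>dilated_simplex_box_polytope_iff\<close>). For given
  m = n - k and k the coordinates can be counted separately: there are as many such points as the
  coefficient of z^k in the product of the factors m * \<theta> i + 1 / (1 - z) (\<open>card_lattice_slice\<close>). Expanding this
  product over subsets T of the coordinates and summing over m with the identity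
  \<Sum>m. m^k t^m = A k / (1 - t)^(k + 1) (\<open>power_fps_eq_weak_excedance_poly\<close>) shows that the h-star polynomial
  is the sum over T of (\<Prod>i\<in>T. \<theta> i) A (card T), where A k counts permutations of k points by weak
  excedances.

  Each A k is palindromic and unimodal, but the centre depends on k, so unimodality of the sum is not
  immediate. Sorting permutations by their fixed points, A k is the image of (t + y)^k under the linear map that
  replaces y^j by the j-th derangement polynomial, so the h-star polynomial is the image of the product
  of the factors 1 + \<theta> i * (t + y). Since \<theta> i \<ge> 1, each factor is a nonnegative combination of t + y and
  1 + t + y, and it suffices to treat the images of (t + y)^s (1 + t + y)^c with s + c = d. The recursion
  of the derangement polynomials shows that such an image is a + b with a and b palindromic and
  unimodal, a with centre d / 2 and b with centre (d + 1) / 2 (\<open>umbral_mixed_power\<close>). These two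
  centres are the same for all terms, and a sum of two palindromic unimodal polynomials whose centres
  differ by 1 / 2 is unimodal (\<open>unimodal_sum_adjacent_centres\<close>).
\<close>

section \<open>Polynomials whose coefficients decrease away from a centre\<close>

text \<open>Coefficients are indexed by integers, with value 0 at negative indices, so that shifts and the
  reflection i \<mapsto> N - i need no side conditions.\<close>

definition icoeff :: "'a::zero poly \<Rightarrow> int \<Rightarrow> 'a" where
  "icoeff p i = (if i < 0 then 0 else coeff p (nat i))"

text \<open>The coefficients do not increase with the distance of the index from N / 2. Equal distances
  give the palindromic property, and comparison with far away indices, where all coefficients are 0,
  shows that the coefficients are nonnegative and supported in {0..N}.\<close>

definition symmetric_unimodal :: "int \<Rightarrow> real poly \<Rightarrow> bool" where
  "symmetric_unimodal N p \<longleftrightarrow> (\<forall>i j. \<bar>2 * i - N\<bar> \<le> \<bar>2 * j - N\<bar> \<longrightarrow> icoeff p j \<le> icoeff p i)"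

lemma symmetric_unimodalD:
  "symmetric_unimodal N p \<Longrightarrow> \<bar>2 * i - N\<bar> \<le> \<bar>2 * j - N\<bar> \<Longrightarrow> icoeff p j \<le> icoeff p i"
  by (auto simp: symmetric_unimodal_def)

lemma icoeff_0 [simp]: "icoeff 0 i = 0"
  by (simp add: icoeff_def)

lemma icoeff_add: "icoeff (p + q) i = icoeff p i + icoeff (q :: 'a::comm_monoid_add poly) i"
  by (simp add: icoeff_def)

lemma icoeff_smult: "icoeff (smult c p) i = c * icoeff (p :: 'a::comm_semiring_0 poly) i"
  by (simp add: icoeff_def)

lemma icoeff_sum: "icoeff (sum f A) i = (\<Sum>x\<in>A. icoeff (f x :: 'a::comm_monoid_add poly) i)"
  by (simp add: icoeff_def coeff_sum)

lemma icoeff_monom_mult: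
  "icoeff (monom 1 k * p) i = icoeff (p :: 'a::comm_semiring_1 poly) (i - int k)"
  by (auto simp: icoeff_def coeff_monom_mult nat_diff_distrib' not_less)

lemma symmetric_unimodal_coeff_eq_0:
  assumes p: "symmetric_unimodal N p" and i: "int i > N"
  shows "coeff p i = 0"
proof -
  have "icoeff p (int i) \<le> icoeff p (N - int i)" "icoeff p (N - int i) \<le> icoeff p (int i)"
    by (intro symmetric_unimodalD[OF p]; simp)+
  then show ?thesis
    using i by (simp add: icoeff_def)
qed

lemma symmetric_unimodal_0: "symmetric_unimodal N 0"
  by (simp add: symmetric_unimodal_def)

lemma symmetric_unimodal_1: "symmetric_unimodal 0 1"
  by (auto simp: symmetric_unimodal_def icoeff_def)

lemma symmetric_unimodal_add:
  "symmetric_unimodal N p \<Longrightarrow> symmetric_unimodal N q \<Longrightarrow> symmetric_unimodal N (p + q)"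
  unfolding symmetric_unimodal_def icoeff_add by (meson add_mono)

lemma symmetric_unimodal_smult:
  "c \<ge> 0 \<Longrightarrow> symmetric_unimodal N p \<Longrightarrow> symmetric_unimodal N (smult c p)"
  unfolding symmetric_unimodal_def icoeff_smult by (meson mult_left_mono)

lemma symmetric_unimodal_sum:
  "(\<And>x. x \<in> A \<Longrightarrow> symmetric_unimodal N (f x)) \<Longrightarrow> symmetric_unimodal N (sum f A)"
  by (induction A rule: infinite_finite_induct)
     (auto intro: symmetric_unimodal_0 symmetric_unimodal_add)

lemma symmetric_unimodal_monom_mult:
  assumes "symmetric_unimodal N p"
  shows "symmetric_unimodal (N + 2 * int k) (monom 1 k * p)"
  unfolding symmetric_unimodal_def icoeff_monom_mult
  by (intro allI impI symmetric_unimodalD[OF assms]) (simp add: algebra_simps)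

definition geometric_poly :: "nat \<Rightarrow> real poly" where
  "geometric_poly m = (\<Sum>k<m. monom 1 k)"

lemma geometric_poly_telescope: "(1 - monom 1 1) * geometric_poly m = 1 - monom 1 m"
proof (induction m)
  case (Suc m)
  have "(1 - monom 1 1) * geometric_poly (Suc m) =
      (1 - monom 1 1) * geometric_poly m + (1 - monom 1 1) * monom 1 m"
    by (simp add: geometric_poly_def distrib_left)
  also have "\<dots> = 1 - monom 1 (Suc m)"
    unfolding Suc by (simp add: left_diff_distrib mult_monom)
  finally show ?case .
qed (simp add: geometric_poly_def monom_0)

lemma symmetric_unimodalI_step:
  assumes sym: "\<And>i. icoeff p (N - i) = icoeff p i"
    and step: "\<And>i. 2 * i + 1 \<ge> N \<Longrightarrow> icoeff p (i + 1) \<le> icoeff p i"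
  shows "symmetric_unimodal N p"
proof -
  have mono: "icoeff p (i + int k) \<le> icoeff p i" if "2 * i + 1 \<ge> N" for i k
  proof (induction k)
    case (Suc k)
    have "icoeff p (i + int k + 1) \<le> icoeff p (i + int k)"
      using that by (intro step) auto
    with Suc show ?case by (simp add: algebra_simps)
  qed simp
  have right: "icoeff p j \<le> icoeff p i" if "2 * i \<ge> N" "i \<le> j" for i j
    using mono[of i "nat (j - i)"] that by simp
  show ?thesis unfolding symmetric_unimodal_def
  proof (intro allI impI)
    fix i j :: int assume le: "\<bar>2 * i - N\<bar> \<le> \<bar>2 * j - N\<bar>"
    \<comment> \<open>The indices are reflected to the right of the centre.\<close>
    define i' where "i' = (if 2 * i \<ge> N then i else N - i)"
    define j' where "j' = (if 2 * j \<ge> N then j else N - j)"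
    have "icoeff p j' \<le> icoeff p i'"
      using le by (intro right) (auto simp: i'_def j'_def split: if_splits)
    then show "icoeff p j \<le> icoeff p i"
      using sym by (auto simp: i'_def j'_def split: if_splits)
  qed
qed

text \<open>The i-th coefficient of the product is the sum of p over the window {i - m + 1..i}. Moving
  the window by one step away from the centre replaces the coefficient at one end by a coefficient
  that is at least as far from N / 2.\<close>

lemma symmetric_unimodal_geometric_mult:
  assumes p: "symmetric_unimodal N p"
  shows "symmetric_unimodal (N + int m - 1) (geometric_poly m * p)"
proof (rule symmetric_unimodalI_step)
  have c: "icoeff (geometric_poly m * p) i = (\<Sum>k<m. icoeff p (i - int k))" for i
    by (simp add: geometric_poly_def sum_distrib_right icoeff_sum icoeff_monom_mult)
  show "icoeff (geometric_poly m * p) (N + int m - 1 - i) = icoeff (geometric_poly m * p) i" for i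
  proof -
    have "(\<Sum>k<m. icoeff p (N + int m - 1 - i - int k)) = (\<Sum>k<m. icoeff p (i - int (m - Suc k)))"
    proof (intro sum.cong refl antisym symmetric_unimodalD[OF p])
    qed (auto simp: of_nat_diff)
    then show ?thesis
      unfolding c sum.nat_diff_reindex[of "\<lambda>k. icoeff p (i - int k)"] .
  qed
  fix i assume i: "2 * i + 1 \<ge> N + int m - 1"
  show "icoeff (geometric_poly m * p) (i + 1) \<le> icoeff (geometric_poly m * p) i"
  proof (cases m)
    case (Suc m')
    have "icoeff p (i + 1) \<le> icoeff p (i - int m')"
      using i Suc by (intro symmetric_unimodalD[OF p]) auto
    then show ?thesis
      unfolding c[unfolded Suc] Suc sum.lessThan_Suc[of "\<lambda>k. icoeff p (i - int k)"]
        sum.lessThan_Suc_shift[of "\<lambda>k. icoeff p (i + 1 - int k)"] by simp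
  qed (simp add: geometric_poly_def)
qed

lemma symmetric_unimodal_one_plus_X_power_mult:
  assumes "symmetric_unimodal N p"
  shows "symmetric_unimodal (N + int l) ((1 + monom 1 1) ^ l * p)"
proof (induction l)
  case (Suc l)
  have "geometric_poly 2 = 1 + monom 1 1"
    by (simp add: geometric_poly_def numeral_2_eq_2 monom_0)
  with symmetric_unimodal_geometric_mult[OF Suc, of 2] show ?case
    by (simp add: mult.assoc algebra_simps)
qed (use assms in simp)

text \<open>The midpoint i + 1/2 of a step is never strictly between the centres N / 2 and
  (N + 1) / 2: both summands increase up to the index
  (N + 1) div 2, and both decrease from there on.\<close>

lemma unimodal_sum_adjacent_centres:
  assumes p: "symmetric_unimodal (int N) p" and q: "symmetric_unimodal (int N + 1) q"
  shows "unimodal N (coeff (p + q))"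
proof -
  have coeff: "coeff (p + q) i = icoeff p (int i) + icoeff q (int i)" for i
    by (simp add: icoeff_def)
  have "coeff (p + q) i \<le> coeff (p + q) (Suc i)" if "i < (N + 1) div 2" for i
    unfolding coeff using that
    by (intro add_mono symmetric_unimodalD[OF p] symmetric_unimodalD[OF q]) auto
  moreover have "coeff (p + q) (Suc i) \<le> coeff (p + q) i" if "i \<ge> (N + 1) div 2" for i
    unfolding coeff using that
    by (intro add_mono symmetric_unimodalD[OF p] symmetric_unimodalD[OF q]) auto
  ultimately show ?thesis
    unfolding unimodal_def by (intro exI[of _ "(N + 1) div 2"]) auto
qed

section \<open>Derangement polynomials and the umbral functional\<close>

text \<open>The polynomial counts derangements of n points by excedances: its exponential generating
  function is (1 - t) / (exp (t z) - t exp z), and the recursion is obtained by clearing the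
  denominator and dividing by 1 - t. In this form each summand is a product of palindromic unimodal
  polynomials, centred at n / 2.\<close>

fun derangement_poly :: "nat \<Rightarrow> real poly" where
  "derangement_poly n = (if n = 0 then 1 else
     (\<Sum>m = 2..n. smult (real (n choose m))
        (monom 1 1 * geometric_poly (m - 1) * derangement_poly (n - m))))"

declare derangement_poly.simps [simp del]

lemma derangement_poly_0 [simp]: "derangement_poly 0 = 1"
  by (simp add: derangement_poly.simps)

lemma symmetric_unimodal_derangement_poly: "symmetric_unimodal (int n) (derangement_poly n)"
proof (induction n rule: less_induct)
  case (less n)
  show ?case
  proof (cases "n = 0")
    case False
    have "symmetric_unimodal (int n) (smult (real (n choose m))
        (monom 1 1 * geometric_poly (m - 1) * derangement_poly (n - m)))" if "m \<in> {2..n}" for m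
    proof -
      have "symmetric_unimodal (int (n - m) + int (m - 1) - 1 + 2 * int 1)
         (monom 1 1 * (geometric_poly (m - 1) * derangement_poly (n - m)))"
        using that by (intro symmetric_unimodal_monom_mult symmetric_unimodal_geometric_mult less) auto
      then show ?thesis
        using that by (intro symmetric_unimodal_smult) (simp_all add: of_nat_diff mult.assoc)
    qed
    then show ?thesis
      unfolding derangement_poly.simps[of n] if_not_P[OF False] by (rule symmetric_unimodal_sum)
  qed (simp add: symmetric_unimodal_1)
qed

text \<open>This is the defining recursion multiplied by 1 - t, with all terms on one side. The
  polynomial \<open>monom 1 1\<close> is the variable t. If a symbol d is introduced whose j-th power stands for the
  j-th derangement polynomial, the identity is (t + d)^k = t (1 + d)^k.\<close>

lemma derangement_poly_recurrence:
  assumes "k > 0"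
  shows "(\<Sum>j\<le>k. smult (real (k choose j)) ((monom 1 j - monom 1 1) * derangement_poly (k - j))) = 0"
proof -
  define f where "f j = smult (real (k choose j)) ((monom 1 j - monom 1 1) * derangement_poly (k - j))" for j
  have f: "f j = - ((1 - monom 1 1) * smult (real (k choose j))
        (monom 1 1 * geometric_poly (j - 1) * derangement_poly (k - j)))" if "j \<in> {2..k}" for j
  proof -
    have "(1 - monom 1 1) * (monom 1 1 * geometric_poly (j - 1)) = monom 1 1 * (1 - monom (1::real) (j - 1))"
      by (simp only: mult.left_commute[of _ "monom 1 1"] geometric_poly_telescope)
    also have "\<dots> = monom 1 1 - monom 1 j"
      using that by (simp add: right_diff_distrib mult_monom)
    finally have shift: "- ((1 - monom 1 1) * (monom 1 1 * geometric_poly (j - 1))) = monom 1 j - monom (1::real) 1"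
      by simp
    show ?thesis
      unfolding f_def shift[symmetric]
      by (simp only: mult_minus_left smult_minus_right mult_smult_right mult.assoc)
  qed
  have "{..k} = insert 0 (insert 1 {2..k})"
    using assms by auto
  then have "sum f {..k} = f 0 + (f 1 + sum f {2..k})"
    by simp
  also have "f 1 = 0"
    by (simp add: f_def)
  also have "f 0 = (1 - monom 1 1) * derangement_poly k"
    by (simp add: f_def)
  also have "sum f {2..k} = - ((1 - monom 1 1) * derangement_poly k)"
    using assms by (simp add: f sum_negf sum_distrib_left derangement_poly.simps[of k])
  finally show ?thesis
    by (simp add: f_def)
qed

text \<open>The linear map over the ring of polynomials in t that sends the k-th power of the outer
  variable y to the k-th derangement polynomial. Products of linear forms in y can then be expanded
  in different ways before the map is applied.\<close>

definition umbral :: "real poly poly \<Rightarrow> real poly" where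
  "umbral p = (\<Sum>i\<le>degree p. coeff p i * derangement_poly i)"

lemma umbral_eq_sum: "degree p \<le> n \<Longrightarrow> umbral p = (\<Sum>i\<le>n. coeff p i * derangement_poly i)"
  unfolding umbral_def by (rule sum.mono_neutral_left) (auto simp: coeff_eq_0)

lemma umbral_add: "umbral (p + q) = umbral p + umbral q"
proof -
  define n where "n = max (degree p) (degree q)"
  have "degree (p + q) \<le> n"
    unfolding n_def by (rule degree_add_le_max)
  then show ?thesis
    by (simp add: umbral_eq_sum[of _ n] n_def ring_distribs sum.distrib)
qed

lemma umbral_smult: "umbral (smult c p) = c * umbral p"
  by (subst umbral_eq_sum[of _ "degree p"])
     (simp_all add: umbral_def degree_smult_le sum_distrib_left mult.assoc)

lemma umbral_0 [simp]: "umbral 0 = 0"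
  by (simp add: umbral_def)

lemma umbral_sum: "umbral (sum f A) = (\<Sum>x\<in>A. umbral (f x))"
  by (induction A rule: infinite_finite_induct) (simp_all add: umbral_add)

lemma umbral_X_power: "umbral ([:0, 1:] ^ k) = derangement_poly k"
proof -
  have "umbral (monom 1 k) = (\<Sum>i\<le>k. if k = i then derangement_poly i else 0)"
    unfolding umbral_def by (intro sum.cong) (auto simp: degree_monom_eq)
  then show ?thesis
    by (simp add: monom_altdef)
qed

text \<open>The map sends (t + y)^k to the generating polynomial of the permutations of k points by weak
  excedances: a permutation is a set of fixed points, of weight t each, together with a derangement
  of the other points. For k > 0 this is t times the k-th Eulerian polynomial.\<close>

definition weak_excedance_poly :: "nat \<Rightarrow> real poly" where
  "weak_excedance_poly k = umbral ([:monom 1 1, 1:] ^ k)"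

lemma smult_sum_right: "smult c (sum f A) = (\<Sum>x\<in>A. smult c (f x))"
  by (induction A rule: infinite_finite_induct) (simp_all add: smult_add_right)

lemma linear_poly_power:
  fixes r :: "real poly"
  shows "[:r, 1:] ^ k = (\<Sum>j\<le>k. smult (smult (real (k choose j)) (r ^ j)) ([:0, 1:] ^ (k - j)))"
proof -
  have "[:r, 1:] = [:r:] + [:0, 1:]"
    by simp
  then show ?thesis
    by (simp only: binomial_ring) (simp add: of_nat_poly poly_const_pow mult.assoc)
qed

lemma umbral_linear_power:
  "umbral ([:r, 1:] ^ k) = (\<Sum>j\<le>k. smult (real (k choose j)) (r ^ j * derangement_poly (k - j)))"
  by (simp add: linear_poly_power[of r] umbral_sum umbral_smult umbral_X_power)

lemma weak_excedance_poly_0 [simp]: "weak_excedance_poly 0 = 1"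
  using umbral_linear_power[of "monom 1 1" 0] by (simp add: weak_excedance_poly_def)

text \<open>By the recurrence of the derangement polynomials (t + y)^k and t (1 + y)^k have the same image;
  the right-hand side is the binomial expansion with 1 + y = (1 - t) + (t + y).\<close>

lemma weak_excedance_poly_recurrence:
  assumes "k > 0"
  shows "weak_excedance_poly k =
    monom 1 1 * (\<Sum>i\<le>k. smult (real (k choose i)) ((1 - monom 1 1) ^ (k - i) * weak_excedance_poly i))"
proof -
  have "weak_excedance_poly k - monom 1 1 * umbral ([:1, 1:] ^ k) = 0"
    using derangement_poly_recurrence[OF assms]
    by (simp add: weak_excedance_poly_def umbral_linear_power sum_distrib_left monom_power
        sum_subtractf[symmetric] smult_diff_right[symmetric] left_diff_distrib)
  moreover have "([:1, 1:] :: real poly poly) = [:monom 1 1, 1:] + [:1 - monom 1 1:]"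
    by simp
  then have "umbral ([:1, 1:] ^ k) =
    (\<Sum>i\<le>k. smult (real (k choose i)) ((1 - monom 1 1) ^ (k - i) * weak_excedance_poly i))"
    by (simp only: binomial_ring)
       (simp add: umbral_sum umbral_smult of_nat_poly poly_const_pow mult.commute mult.left_commute
         weak_excedance_poly_def)
  ultimately show ?thesis
    by simp
qed

lemma degree_weak_excedance_poly: "degree (weak_excedance_poly k) \<le> k"
proof -
  have "degree (monom (1::real) j * derangement_poly (k - j)) \<le> k" if "j \<le> k" for j
  proof -
    have "degree (derangement_poly (k - j)) \<le> k - j"
      by (rule degree_le) (use symmetric_unimodal_coeff_eq_0[OF symmetric_unimodal_derangement_poly] in auto)
    then have "degree (monom (1::real) j * derangement_poly (k - j)) \<le> j + (k - j)"
      by (meson add_mono degree_monom_le degree_mult_le order_trans)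
    with that show ?thesis by simp
  qed
  then show ?thesis
    unfolding weak_excedance_poly_def umbral_linear_power
    by (intro degree_sum_le) (auto simp: monom_power intro: order_trans[OF degree_smult_le])
qed

section \<open>Decomposition into two palindromic parts\<close>

text \<open>The term m = 0 is the n-th derangement polynomial, the term m = 1 vanishes, and the terms
  m \<ge> 2 are negative. Expanding the first by its recursion gives the same terms with the binomial
  coefficients of n in place of those of s, so the negative terms are absorbed because s \<le> n.\<close>

lemma symmetric_unimodal_derangement_remainder:
  assumes "s \<le> n"
  shows "symmetric_unimodal (int n)
    (\<Sum>m\<le>s. smult (real (s choose m))
      ((monom 1 m - monom 1 1 * geometric_poly m) * derangement_poly (n - m)))"
proof (cases "s = 0")
  case True
  then show ?thesis
    by (simp add: geometric_poly_def monom_0 symmetric_unimodal_derangement_poly)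
next
  case False
  define D where "D m = monom 1 1 * geometric_poly (m - 1) * derangement_poly (n - m)" for m
  define f where "f m = smult (real (s choose m))
      ((monom 1 m - monom 1 1 * geometric_poly m) * derangement_poly (n - m))" for m
  have f: "f m = - smult (real (s choose m)) (D m)" if "m \<in> {2..s}" for m
  proof -
    have "geometric_poly m = geometric_poly (m - 1) + monom 1 (m - 1)"
      using that by (cases m) (simp_all add: geometric_poly_def)
    then have "monom 1 m - monom 1 1 * geometric_poly m = - (monom 1 1 * geometric_poly (m - 1))"
      using that by (simp add: distrib_left mult_monom)
    then show ?thesis
      by (simp add: f_def D_def)
  qed
  have "{..s} = insert 0 (insert 1 {2..s})"
    using False by auto
  then have "sum f {..s} = f 0 + (f 1 + sum f {2..s})"
    by simp
  also have "f 1 = 0"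
    by (simp add: f_def geometric_poly_def monom_0)
  also have "f 0 = derangement_poly n"
    by (simp add: f_def geometric_poly_def monom_0)
  also have "sum f {2..s} = - (\<Sum>m = 2..s. smult (real (s choose m)) (D m))"
    by (simp add: f sum_negf)
  also have "(\<Sum>m = 2..s. smult (real (s choose m)) (D m)) =
      (\<Sum>m = 2..n. smult (real (s choose m)) (D m))"
    using assms by (intro sum.mono_neutral_left) (auto simp: not_le binomial_eq_0)
  also have "derangement_poly n = (\<Sum>m = 2..n. smult (real (n choose m)) (D m))"
    using False assms unfolding D_def by (subst derangement_poly.simps) simp
  also have "(\<Sum>m = 2..n. smult (real (n choose m)) (D m)) +
      (0 + - (\<Sum>m = 2..n. smult (real (s choose m)) (D m))) =
      (\<Sum>m = 2..n. smult (real (n choose m) - real (s choose m)) (D m))"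
    by (simp add: smult_diff_left sum_subtractf)
  finally have sum: "sum f {..s} = (\<Sum>m = 2..n. smult (real (n choose m) - real (s choose m)) (D m))" .
  have "symmetric_unimodal (int n) (smult (real (n choose m) - real (s choose m)) (D m))"
    if "m \<in> {2..n}" for m
  proof (rule symmetric_unimodal_smult)
    show "0 \<le> real (n choose m) - real (s choose m)"
      using binomial_right_mono[OF assms] by simp
    have "symmetric_unimodal (int (n - m) + int (m - 1) - 1 + 2 * int 1)
       (monom 1 1 * (geometric_poly (m - 1) * derangement_poly (n - m)))"
      by (intro symmetric_unimodal_monom_mult symmetric_unimodal_geometric_mult
          symmetric_unimodal_derangement_poly)
    then show "symmetric_unimodal (int n) (D m)"
      using that by (simp add: D_def of_nat_diff mult.assoc)
  qed
  then have "symmetric_unimodal (int n) (sum f {..s})"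
    unfolding sum by (rule symmetric_unimodal_sum)
  then show ?thesis
    unfolding f_def .
qed

text \<open>Expand both powers. A summand contains a factor t^m, from m fixed points of weight t, which
  moves its centre away from the middle. Write t^m as the sum of t (1 + ... + t^(m - 1)) and a remainder.
  The first parts all have their centre at (s + c + 1) / 2. The remainders are negative for m \<ge> 2,
  but for a fixed exponent l of 1 + t they add up to the polynomial of
  \<open>symmetric_unimodal_derangement_remainder\<close> with n = s + c - l, centred at n / 2, and
  multiplication by (1 + t)^l moves the centre to (s + c) / 2.\<close>

lemma umbral_mixed_power:
  obtains a b where "symmetric_unimodal (int (s + c)) a" "symmetric_unimodal (int (s + c) + 1) b"
    "umbral ([:monom 1 1, 1:] ^ s * [:1 + monom 1 1, 1:] ^ c) = a + b"
proof
  define S where "S q = (\<Sum>l\<le>c. smult (real (c choose l)) ((1 + monom 1 1) ^ l *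
      (\<Sum>m\<le>s. smult (real (s choose m)) (q m * derangement_poly (s + c - l - m)))))" for q
  have "umbral ([:monom 1 1, 1:] ^ s * [:1 + monom 1 1, 1:] ^ c) = S (monom 1)"
  proof -
    have "umbral ([:monom 1 1, 1:] ^ s * [:1 + monom 1 1, 1:] ^ c) =
      (\<Sum>l\<le>c. \<Sum>m\<le>s. smult (real (c choose l)) ((1 + monom 1 1) ^ l) *
        (smult (real (s choose m)) (monom 1 1 ^ m) * umbral ([:0, 1:] ^ (c - l) * [:0, 1:] ^ (s - m))))"
      unfolding linear_poly_power[of "monom 1 1"] linear_poly_power[of "1 + monom 1 1"] sum_product
      by (subst sum.swap) (simp add: umbral_sum umbral_smult mult_ac)
    also have "\<dots> = S (monom 1)"
      unfolding S_def sum_distrib_left smult_sum_right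
    proof (intro sum.cong refl)
      fix l m assume "l \<in> {..c}" "m \<in> {..s}"
      then have "c - l + (s - m) = s + c - l - m"
        by simp
      then have "umbral ([:0, 1:] ^ (c - l) * [:0, 1:] ^ (s - m)) = derangement_poly (s + c - l - m)"
        by (simp only: power_add[symmetric] umbral_X_power)
      then show "smult (real (c choose l)) ((1 + monom 1 1) ^ l) *
          (smult (real (s choose m)) (monom 1 1 ^ m) * umbral ([:0, 1:] ^ (c - l) * [:0, 1:] ^ (s - m))) =
        smult (real (c choose l)) ((1 + monom 1 1) ^ l *
          smult (real (s choose m)) (monom 1 m * derangement_poly (s + c - l - m)))"
        by (simp add: monom_power mult_ac)
    qed
    finally show ?thesis .
  qed
  also have "\<dots> = S (\<lambda>m. monom 1 m - monom 1 1 * geometric_poly m) + S (\<lambda>m. monom 1 1 * geometric_poly m)"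
    unfolding S_def by (simp add: sum.distrib[symmetric] smult_add_right[symmetric]
        distrib_left[symmetric] distrib_right[symmetric])
  finally show "umbral ([:monom 1 1, 1:] ^ s * [:1 + monom 1 1, 1:] ^ c) =
      S (\<lambda>m. monom 1 m - monom 1 1 * geometric_poly m) + S (\<lambda>m. monom 1 1 * geometric_poly m)" .
  show "symmetric_unimodal (int (s + c)) (S (\<lambda>m. monom 1 m - monom 1 1 * geometric_poly m))"
    unfolding S_def
  proof (intro symmetric_unimodal_sum symmetric_unimodal_smult)
    fix l assume "l \<in> {..c}"
    then show "symmetric_unimodal (int (s + c)) ((1 + monom 1 1) ^ l *
      (\<Sum>m\<le>s. smult (real (s choose m))
        ((monom 1 m - monom 1 1 * geometric_poly m) * derangement_poly (s + c - l - m))))"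
      using symmetric_unimodal_one_plus_X_power_mult[OF
          symmetric_unimodal_derangement_remainder[of s "s + c - l"], of l]
      by (simp add: of_nat_diff)
  qed simp
  show "symmetric_unimodal (int (s + c) + 1) (S (\<lambda>m. monom 1 1 * geometric_poly m))"
    unfolding S_def
  proof (intro symmetric_unimodal_sum symmetric_unimodal_smult)
    fix l assume l: "l \<in> {..c}"
    have "symmetric_unimodal (int (s + c) + 1 - int l)
        (monom 1 1 * geometric_poly m * derangement_poly (s + c - l - m))" if "m \<le> s" for m
    proof -
      have "symmetric_unimodal (int (s + c - l - m) + int m - 1 + 2 * int 1)
         (monom 1 1 * (geometric_poly m * derangement_poly (s + c - l - m)))"
        by (intro symmetric_unimodal_monom_mult symmetric_unimodal_geometric_mult
            symmetric_unimodal_derangement_poly)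
      moreover have "int (s + c - l - m) + int m - 1 + 2 * int 1 = int (s + c) + 1 - int l"
        using that l by auto
      ultimately show ?thesis
        by (simp only: mult.assoc)
    qed
    then have "symmetric_unimodal (int (s + c) + 1 - int l) (\<Sum>m\<le>s. smult (real (s choose m))
        (monom 1 1 * geometric_poly m * derangement_poly (s + c - l - m)))"
      by (intro symmetric_unimodal_sum symmetric_unimodal_smult) auto
    from symmetric_unimodal_one_plus_X_power_mult[OF this, of l]
    show "symmetric_unimodal (int (s + c) + 1) ((1 + monom 1 1) ^ l *
      (\<Sum>m\<le>s. smult (real (s choose m))
        (monom 1 1 * geometric_poly m * derangement_poly (s + c - l - m))))"
      by simp
  qed simp
qed

lemma prod_smult_add:
  fixes y z :: "'a::comm_semiring_1 poly" and c :: "'n::finite \<Rightarrow> 'a"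
  shows "(\<Prod>i\<in>UNIV. smult (c i) y + z) = (\<Sum>S\<in>UNIV. smult (\<Prod>i\<in>S. c i) (y ^ card S * z ^ card (- S)))"
  by (subst prod_add) (simp_all add: prod_smult Compl_eq_Diff_UNIV)

text \<open>The umbral map is applied to a product, which can be expanded either in the \<theta> i, as the
  lattice point count requires, or in the numbers \<theta> i - 1, as unimodality requires.\<close>

definition simplex_box_hstar :: "('n::finite \<Rightarrow> nat) \<Rightarrow> real poly" where
  "simplex_box_hstar \<theta> = umbral (\<Prod>i\<in>UNIV. 1 + smult (of_nat (\<theta> i)) [:monom 1 1, 1:])"

lemma simplex_box_hstar_altdef:
  "simplex_box_hstar \<theta> = (\<Sum>T\<in>UNIV. smult (real (\<Prod>i\<in>T. \<theta> i)) (weak_excedance_poly (card T)))"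
proof -
  have "simplex_box_hstar \<theta> = umbral (\<Sum>T\<in>UNIV. smult (of_nat (\<Prod>i\<in>T. \<theta> i)) ([:monom 1 1, 1:] ^ card T))"
    unfolding simplex_box_hstar_def add.commute[of 1] prod_smult_add
    by (simp only: of_nat_prod power_one mult_1_right)
  then show ?thesis
    by (simp add: umbral_sum umbral_smult weak_excedance_poly_def of_nat_poly)
qed

lemma degree_simplex_box_hstar: "degree (simplex_box_hstar (\<theta> :: 'n::finite \<Rightarrow> nat)) \<le> CARD('n)"
  unfolding simplex_box_hstar_altdef
proof (intro degree_sum_le)
  fix T :: "'n set"
  have "degree (weak_excedance_poly (card T)) \<le> CARD('n)"
    using degree_weak_excedance_poly[of "card T"] card_mono[of UNIV T] by simp
  then show "degree (smult (real (prod \<theta> T)) (weak_excedance_poly (card T))) \<le> CARD('n)"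
    by (rule order_trans[OF degree_smult_le])
qed simp

text \<open>With \<eta> i = \<theta> i - 1 \<ge> 0, each factor 1 + \<theta> i * (t + y) is the sum of \<eta> i * (t + y) and 1 + t + y. The
  product is therefore a nonnegative combination of mixed powers whose exponents have sum d, and
  these split with the same pair of centres d / 2 and (d + 1) / 2.\<close>

lemma unimodal_simplex_box_hstar:
  fixes \<theta> :: "'n::finite \<Rightarrow> nat"
  assumes "\<And>i. \<theta> i > 0"
  shows "unimodal CARD('n) (coeff (simplex_box_hstar \<theta>))"
proof -
  define \<eta> where "\<eta> i = \<theta> i - 1" for i
  define f where "f S = umbral ([:monom 1 1, 1:] ^ card S * [:1 + monom 1 1, 1:] ^ card (- S))"
    for S :: "'n set"
  have "(1 + smult (of_nat (\<theta> i)) [:monom 1 1, 1:] :: real poly poly) =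
      smult (of_nat (\<eta> i)) [:monom 1 1, 1:] + [:1 + monom 1 1, 1:]" for i
  proof -
    have "\<theta> i = Suc (\<eta> i)"
      using assms[of i] by (simp add: \<eta>_def)
    then show ?thesis
      by (simp add: algebra_simps one_pCons)
  qed
  then have "simplex_box_hstar \<theta> = umbral (\<Prod>i\<in>UNIV. smult (of_nat (\<eta> i)) [:monom 1 1, 1:] + [:1 + monom 1 1, 1:])"
    by (simp only: simplex_box_hstar_def)
  also have "(\<Prod>i\<in>UNIV. smult (of_nat (\<eta> i)) [:monom 1 1, 1:] + [:1 + monom 1 1, 1:] :: real poly poly) =
      (\<Sum>S\<in>UNIV. smult (of_nat (\<Prod>i\<in>S. \<eta> i)) ([:monom 1 1, 1:] ^ card S * [:1 + monom 1 1, 1:] ^ card (- S)))"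
    unfolding prod_smult_add by (simp only: of_nat_prod)
  finally have h: "simplex_box_hstar \<theta> = (\<Sum>S\<in>UNIV. smult (real (\<Prod>i\<in>S. \<eta> i)) (f S))"
    by (simp add: umbral_sum umbral_smult f_def of_nat_poly)
  have "\<forall>S :: 'n set. \<exists>a b. symmetric_unimodal (int CARD('n)) a \<and>
      symmetric_unimodal (int CARD('n) + 1) b \<and> f S = a + b"
  proof
    fix S :: "'n set"
    have "card S + card (- S) = CARD('n)"
      by (metis card_Un_disjoint finite inf_compl_bot sup_compl_top)
    then show "\<exists>a b. symmetric_unimodal (int CARD('n)) a \<and>
      symmetric_unimodal (int CARD('n) + 1) b \<and> f S = a + b"
      unfolding f_def by (metis umbral_mixed_power)
  qed
  then obtain a b where ab: "\<And>S. symmetric_unimodal (int CARD('n)) (a S)"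
      "\<And>S. symmetric_unimodal (int CARD('n) + 1) (b S)" "\<And>S. f S = a S + b S"
    by metis
  have "simplex_box_hstar \<theta> = (\<Sum>S\<in>UNIV. smult (real (\<Prod>i\<in>S. \<eta> i)) (a S)) +
      (\<Sum>S\<in>UNIV. smult (real (\<Prod>i\<in>S. \<eta> i)) (b S))"
    by (simp add: h ab(3) smult_add_right sum.distrib)
  moreover have "unimodal CARD('n) (coeff ((\<Sum>S\<in>UNIV. smult (real (\<Prod>i\<in>S. \<eta> i)) (a S)) +
      (\<Sum>S\<in>UNIV. smult (real (\<Prod>i\<in>S. \<eta> i)) (b S))))"
    using ab by (intro unimodal_sum_adjacent_centres symmetric_unimodal_sum symmetric_unimodal_smult)
      (auto simp: prod_nonneg)
  ultimately show ?thesis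
    by simp
qed

section \<open>Generating functions\<close>

definition geometric_fps :: "real fps" where
  "geometric_fps = Abs_fps (\<lambda>_. 1)"

lemma geometric_fps_nth [simp]: "fps_nth geometric_fps n = 1"
  by (simp add: geometric_fps_def)

lemma geometric_fps_inverse: "geometric_fps * (1 - fps_X) = 1"
  by (rule fps_ext) (auto simp: right_diff_distrib geometric_fps_def)

lemma geometric_fps_power_nth: "fps_nth (geometric_fps ^ Suc d) m = real ((m + d) choose d)"
proof (induction d arbitrary: m)
  case (Suc d)
  have "fps_nth (geometric_fps ^ Suc (Suc d)) m = (\<Sum>i\<le>m. fps_nth (geometric_fps ^ Suc d) i)"
    by (subst power_Suc2) (simp add: fps_mult_nth atLeast0AtMost)
  also have "\<dots> = real (\<Sum>i\<le>m. (d + i) choose i)"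
    by (simp only: Suc of_nat_sum) (simp add: binomial_symmetric[of d] add.commute)
  also have "\<dots> = real ((m + Suc d) choose Suc d)"
    unfolding sum_choose_lower by (subst binomial_symmetric) (simp_all add: add.commute)
  finally show ?case .
qed simp

definition power_fps :: "nat \<Rightarrow> real fps" where
  "power_fps k = Abs_fps (\<lambda>m. real m ^ k)"

lemma power_fps_nth [simp]: "fps_nth (power_fps k) m = real m ^ k"
  by (simp add: power_fps_def)

text \<open>The binomial expansion of (m + 1)^k, read as an identity of generating functions.\<close>

lemma power_fps_recurrence:
  assumes "k > 0"
  shows "power_fps k = fps_X * (\<Sum>i\<le>k. fps_const (real (k choose i)) * power_fps i)"
proof (rule fps_ext)
  fix n
  show "fps_nth (power_fps k) n =
      fps_nth (fps_X * (\<Sum>i\<le>k. fps_const (real (k choose i)) * power_fps i)) n"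
  proof (cases n)
    case (Suc m)
    have "real (Suc m) ^ k = (real m + 1) ^ k"
      by (simp add: add.commute)
    also have "\<dots> = (\<Sum>i\<le>k. real (k choose i) * real m ^ i)"
      by (simp only: binomial_ring) simp
    finally show ?thesis
      by (simp add: Suc fps_sum_nth)
  qed (use assms in simp)
qed

text \<open>The classical identity for Eulerian polynomials. After multiplication by
  (1 - X)^(k + 1) the power series satisfy the same recurrence as the polynomials, in which the k-th term also occurs on the right with the factor X.
  By induction, the difference D of the two k-th terms satisfies D = X D, and therefore D = 0.\<close>

lemma power_fps_eq_weak_excedance_poly:
  "power_fps k * (1 - fps_X) ^ Suc k = fps_of_poly (weak_excedance_poly k)"
proof (induction k rule: less_induct)
  case (less k)
  show ?case
  proof (cases "k = 0")
    case True
    have "power_fps 0 = geometric_fps"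
      by (simp add: power_fps_def geometric_fps_def)
    with True show ?thesis
      by (simp add: geometric_fps_inverse)
  next
    case False
    define G where "G i = power_fps i * (1 - fps_X) ^ Suc i" for i
    define g where "g i = fps_of_poly (weak_excedance_poly i)" for i
    define c where "c i = fps_const (real (k choose i)) * (1 - fps_X :: real fps) ^ (k - i)" for i
    have X: "fps_of_poly (monom 1 1) = (fps_X :: real fps)"
      by (simp add: fps_of_poly_monom)
    have "g k = fps_of_poly (monom 1 1 *
        (\<Sum>i\<le>k. smult (real (k choose i)) ((1 - monom 1 1) ^ (k - i) * weak_excedance_poly i)))"
      unfolding g_def using False by (intro arg_cong[of _ _ fps_of_poly] weak_excedance_poly_recurrence) simp
    also have "\<dots> = fps_X * (\<Sum>i\<le>k. c i * g i)"
      by (simp only: fps_of_poly_mult fps_of_poly_sum fps_of_poly_smult fps_of_poly_power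
          fps_of_poly_diff fps_of_poly_1 X c_def g_def mult.assoc)
    finally have g: "g k = fps_X * (\<Sum>i\<le>k. c i * g i)" .
    have G: "G k = fps_X * (\<Sum>i\<le>k. c i * G i)"
    proof -
      have "G k = fps_X * (\<Sum>i\<le>k. fps_const (real (k choose i)) * power_fps i) * (1 - fps_X) ^ Suc k"
        using False by (simp add: G_def power_fps_recurrence[of k, symmetric])
      also have "\<dots> = fps_X * (\<Sum>i\<le>k. fps_const (real (k choose i)) * power_fps i * (1 - fps_X) ^ Suc k)"
        by (simp only: mult.assoc sum_distrib_right)
      also have "(\<Sum>i\<le>k. fps_const (real (k choose i)) * power_fps i * (1 - fps_X) ^ Suc k) =
          (\<Sum>i\<le>k. c i * G i)"
      proof (intro sum.cong refl)
        fix i assume "i \<in> {..k}"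
        then have power: "(1 - fps_X :: real fps) ^ Suc k = (1 - fps_X) ^ (k - i) * (1 - fps_X) ^ Suc i"
          by (simp only: power_add[symmetric]) simp
        show "fps_const (real (k choose i)) * power_fps i * (1 - fps_X) ^ Suc k = c i * G i"
          unfolding power c_def G_def by (simp only: mult_ac)
      qed
      finally show ?thesis .
    qed
    have diff: "(\<Sum>i\<le>k. c i * (G i - g i)) = G k - g k"
    proof -
      have "(\<Sum>i\<le>k. c i * (G i - g i)) = (\<Sum>i\<in>{k}. c i * (G i - g i))"
        using less by (intro sum.mono_neutral_right) (auto simp: G_def g_def)
      then show ?thesis
        by (simp add: c_def)
    qed
    have "G k - g k = fps_X * (\<Sum>i\<le>k. c i * G i) - fps_X * (\<Sum>i\<le>k. c i * g i)"
      by (rule arg_cong2[of _ _ _ _ "(-)"]; fact)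
    also have "\<dots> = fps_X * (G k - g k)"
      unfolding diff[symmetric] by (simp only: right_diff_distrib sum_subtractf)
    finally have "G k - g k = fps_X * (G k - g k)" .
    then have "(1 - fps_X) * (G k - g k) = 0"
      by (simp add: left_diff_distrib)
    moreover have "(1 - fps_X :: real fps) \<noteq> 0"
      using geometric_fps_inverse by (metis mult_zero_right zero_neq_one)
    ultimately show ?thesis
      by (simp add: G_def g_def)
  qed
qed

lemma power_fps_altdef:
  "power_fps k = fps_of_poly (weak_excedance_poly k) * geometric_fps ^ Suc k"
proof -
  have "power_fps k = power_fps k * (geometric_fps * (1 - fps_X)) ^ Suc k"
    by (simp add: geometric_fps_inverse)
  also have "\<dots> = fps_of_poly (weak_excedance_poly k) * geometric_fps ^ Suc k"
    by (simp only: power_mult_distrib power_fps_eq_weak_excedance_poly[symmetric] mult_ac)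
  finally show ?thesis .
qed

lemma fps_const_prod: "fps_const (prod f A :: 'a::comm_ring_1) = (\<Prod>x\<in>A. fps_const (f x))"
  by (induction A rule: infinite_finite_induct) (simp_all flip: fps_const_mult)

text \<open>Both sides are expanded over the subsets T of the index set: the powers of m in the product
  on the right, summed over m, give the series of the m^card T, which \<open>power_fps_altdef\<close> turns into a
  weak excedance polynomial over a power of 1 - X.\<close>

lemma simplex_box_hstar_generating_function:
  fixes \<theta> :: "'n::finite \<Rightarrow> nat"
  shows "fps_nth (fps_of_poly (simplex_box_hstar \<theta>) * geometric_fps ^ Suc CARD('n)) n =
    (\<Sum>m\<le>n. fps_nth (\<Prod>i\<in>UNIV. fps_const (real (m * \<theta> i)) + geometric_fps) (n - m))"
proof -
  have split: "geometric_fps ^ Suc CARD('n) = geometric_fps ^ Suc (card T) * geometric_fps ^ card (- T)"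
    for T :: "'n set"
  proof -
    have "Suc CARD('n) = Suc (card T) + card (- T)"
      by (metis add_Suc card_Un_disjoint finite inf_compl_bot sup_compl_top)
    then show ?thesis
      by (simp only: power_add)
  qed
  have "fps_of_poly (simplex_box_hstar \<theta>) * geometric_fps ^ Suc CARD('n) =
      (\<Sum>T\<in>UNIV. fps_const (real (\<Prod>i\<in>T. \<theta> i)) * (power_fps (card T) * geometric_fps ^ card (- T)))"
    unfolding simplex_box_hstar_altdef fps_of_poly_sum fps_of_poly_smult sum_distrib_right
  proof (intro sum.cong refl)
    fix T :: "'n set"
    show "fps_const (real (prod \<theta> T)) * fps_of_poly (weak_excedance_poly (card T)) * geometric_fps ^ Suc CARD('n) =
        fps_const (real (prod \<theta> T)) * (power_fps (card T) * geometric_fps ^ card (- T))"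
      by (simp only: split[of T] power_fps_altdef mult.assoc)
  qed
  then have "fps_nth (fps_of_poly (simplex_box_hstar \<theta>) * geometric_fps ^ Suc CARD('n)) n =
      (\<Sum>T\<in>UNIV. \<Sum>m\<le>n. real (\<Prod>i\<in>T. \<theta> i) * (real m ^ card T * fps_nth (geometric_fps ^ card (- T)) (n - m)))"
    by (simp add: fps_sum_nth fps_mult_nth[of "power_fps _"] sum_distrib_left atLeast0AtMost)
  also have "\<dots> = (\<Sum>m\<le>n. \<Sum>T\<in>UNIV. real (\<Prod>i\<in>T. \<theta> i) * (real m ^ card T * fps_nth (geometric_fps ^ card (- T)) (n - m)))"
    by (rule sum.swap)
  also have "\<dots> = (\<Sum>m\<le>n. fps_nth (\<Prod>i\<in>UNIV. fps_const (real (m * \<theta> i)) + geometric_fps) (n - m))"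
  proof (intro sum.cong refl)
    fix m
    have "(\<Prod>i\<in>UNIV. fps_const (real (m * \<theta> i)) + geometric_fps) =
        (\<Sum>T\<in>UNIV. fps_const (\<Prod>i\<in>T. real (m * \<theta> i)) * geometric_fps ^ card (- T))"
      by (subst prod_add) (simp_all add: Compl_eq_Diff_UNIV fps_const_prod)
    then show "(\<Sum>T\<in>UNIV. real (\<Prod>i\<in>T. \<theta> i) * (real m ^ card T * fps_nth (geometric_fps ^ card (- T)) (n - m))) =
        fps_nth (\<Prod>i\<in>UNIV. fps_const (real (m * \<theta> i)) + geometric_fps) (n - m)"
      by (simp add: fps_sum_nth prod.distrib mult_ac)
  qed
  finally show ?thesis .
qed

text \<open>The binomial coefficients in the definition of the h-star polynomial are the coefficients of
  1 / (1 - X)^(d + 1), shifted by j.\<close>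

lemma hstar_generating_function:
  assumes "degree H \<le> d"
  shows "fps_nth (fps_of_poly H * geometric_fps ^ Suc d) n =
    (\<Sum>j\<le>d. coeff H j * real ((n + d - j) choose d))"
proof -
  have "fps_nth (fps_of_poly H * geometric_fps ^ Suc d) n =
      (\<Sum>j\<le>n. coeff H j * real ((n - j + d) choose d))"
    by (simp only: fps_mult_nth geometric_fps_power_nth fps_of_poly_nth atLeast0AtMost)
  also have "\<dots> = (\<Sum>j\<le>n. coeff H j * real ((n + d - j) choose d))"
    by (intro sum.cong refl) simp
  also have "\<dots> = (\<Sum>j\<le>n + d. coeff H j * real ((n + d - j) choose d))"
    by (intro sum.mono_neutral_left) (auto simp: binomial_eq_0)
  also have "\<dots> = (\<Sum>j\<le>d. coeff H j * real ((n + d - j) choose d))"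
    using assms by (intro sum.mono_neutral_right) (auto intro: coeff_eq_0)
  finally show ?thesis .
qed

section \<open>Counting lattice points\<close>

text \<open>In the n-th dilate of the polytope, an integer point whose negative parts have sum k \<le> n is only required
  to satisfy x i \<le> m * \<theta> i for m = n - k. Once m and k are independent, the coordinates interact only
  through the sum, and the count is a coefficient of a product. The index set I is kept general
  for the induction over the coordinates.\<close>

definition lattice_slice :: "('n \<Rightarrow> nat) \<Rightarrow> 'n set \<Rightarrow> nat \<Rightarrow> nat \<Rightarrow> ('n \<Rightarrow> int) set" where
  "lattice_slice \<theta> I m k =
    {x \<in> (\<Pi>\<^sub>E i\<in>I. {..int (m * \<theta> i)}). (\<Sum>i\<in>I. nat (- x i)) = k}"

lemma lattice_slice_insert:
  assumes I: "finite I" "i \<notin> I"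
  shows "lattice_slice \<theta> (insert i I) m k =
    (\<lambda>(y, g). g(i := y)) ` (SIGMA y:{- int k..int (m * \<theta> i)}. lattice_slice \<theta> I m (k - nat (- y)))"
    (is "?L = ?f ` ?S")
proof (intro equalityI subsetI)
  have sum: "(\<Sum>j\<in>insert i I. nat (- (g(i := y)) j)) = nat (- y) + (\<Sum>j\<in>I. nat (- g j))"
    for g :: "'a \<Rightarrow> int" and y
    using I by (auto intro: sum.cong)
  fix x assume x: "x \<in> ?L"
  then obtain y g where yg: "x = g(i := y)" "y \<le> int (m * \<theta> i)"
      "g \<in> (\<Pi>\<^sub>E j\<in>I. {..int (m * \<theta> j)})"
    by (auto simp: lattice_slice_def PiE_insert_eq simp del: of_nat_mult)
  have "nat (- y) + (\<Sum>j\<in>I. nat (- g j)) = k"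
    using x sum[of g y] by (simp add: lattice_slice_def yg(1))
  then have "- int k \<le> y" "(\<Sum>j\<in>I. nat (- g j)) = k - nat (- y)"
    by linarith+
  with yg show "x \<in> ?f ` ?S"
    by (intro image_eqI[of _ _ "(y, g)"]) (auto simp: lattice_slice_def simp del: of_nat_mult)
next
  have sum: "(\<Sum>j\<in>insert i I. nat (- (g(i := y)) j)) = nat (- y) + (\<Sum>j\<in>I. nat (- g j))"
    for g :: "'a \<Rightarrow> int" and y
    using I by (auto intro: sum.cong)
  fix x assume "x \<in> ?f ` ?S"
  then obtain y g where yg: "x = g(i := y)" "- int k \<le> y" "y \<le> int (m * \<theta> i)"
      "g \<in> lattice_slice \<theta> I m (k - nat (- y))"
    by auto
  have "x \<in> (\<Pi>\<^sub>E j\<in>insert i I. {..int (m * \<theta> j)})"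
    unfolding PiE_insert_eq using yg by (auto simp: lattice_slice_def)
  moreover have "(\<Sum>j\<in>insert i I. nat (- x j)) = k"
    unfolding yg(1) sum using yg by (auto simp: lattice_slice_def)
  ultimately show "x \<in> ?L"
    by (simp add: lattice_slice_def)
qed

text \<open>One coordinate contributes m * \<theta> i positive values, which do not affect the sum, and one value
  -j for each j \<ge> 0, which contributes j to the sum.\<close>

lemma card_lattice_slice:
  assumes "finite I"
  shows "finite (lattice_slice \<theta> I m k) \<and>
    real (card (lattice_slice \<theta> I m k)) =
      fps_nth (\<Prod>i\<in>I. fps_const (real (m * \<theta> i)) + geometric_fps) k"
  using assms
proof (induction I arbitrary: k rule: finite_induct)
  case empty
  have "lattice_slice \<theta> {} m k = (if k = 0 then {\<lambda>_. undefined} else {})"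
    by (auto simp: lattice_slice_def)
  then show ?case
    by simp
next
  case (insert i I)
  define F where "F = (\<Prod>i\<in>I. fps_const (real (m * \<theta> i)) + geometric_fps)"
  define S where "S = (SIGMA y:{- int k..int (m * \<theta> i)}. lattice_slice \<theta> I m (k - nat (- y)))"
  have fin: "finite (lattice_slice \<theta> I m k')" and
    card: "real (card (lattice_slice \<theta> I m k')) = fps_nth F k'" for k'
    using insert.IH by (auto simp: F_def)
  have inj: "inj_on (\<lambda>(y, g). g(i := y)) S"
    by (rule inj_on_subset[OF inj_combinator[OF insert.hyps(2), of "\<lambda>j. {..int (m * \<theta> j)}"]])
       (auto simp: S_def lattice_slice_def)
  have "real (card S) = (\<Sum>y\<in>{- int k..int (m * \<theta> i)}. fps_nth F (k - nat (- y)))"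
    unfolding S_def using fin by (simp add: card[symmetric])
  also have "{- int k..int (m * \<theta> i)} = {1..int (m * \<theta> i)} \<union> {- int k..0}"
    using of_nat_0_le_iff[of "m * \<theta> i", where ?'a = int] by (auto simp del: of_nat_mult)
  also have "(\<Sum>y\<in>\<dots>. fps_nth F (k - nat (- y))) =
      (\<Sum>y\<in>{1..int (m * \<theta> i)}. fps_nth F (k - nat (- y))) + (\<Sum>y\<in>{- int k..0}. fps_nth F (k - nat (- y)))"
    by (rule sum.union_disjoint) auto
  also have "(\<Sum>y\<in>{1..int (m * \<theta> i)}. fps_nth F (k - nat (- y))) = real (m * \<theta> i) * fps_nth F k"
    by (simp del: of_nat_mult)
  also have "(\<Sum>y\<in>{- int k..0}. fps_nth F (k - nat (- y))) = (\<Sum>j\<le>k. fps_nth F (k - j))"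
    by (rule sum.reindex_bij_witness[of _ "\<lambda>j. - int j" "\<lambda>y. nat (- y)"]) auto
  also have "real (m * \<theta> i) * fps_nth F k + \<dots> = fps_nth ((fps_const (real (m * \<theta> i)) + geometric_fps) * F) k"
    by (simp add: distrib_right fps_mult_nth[of geometric_fps] atLeast0AtMost)
  finally have "real (card S) = fps_nth ((fps_const (real (m * \<theta> i)) + geometric_fps) * F) k" .
  moreover have "lattice_slice \<theta> (insert i I) m k = (\<lambda>(y, g). g(i := y)) ` S"
    unfolding S_def by (rule lattice_slice_insert[OF insert.hyps])
  moreover have "finite S"
    unfolding S_def using fin by auto
  ultimately show ?case
    using inj insert.hyps by (simp add: card_image F_def)
qed

definition negative_mass :: "real ^ 'n \<Rightarrow> real" where
  "negative_mass x = (\<Sum>i\<in>UNIV. max 0 (- x $ i))"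

lemma negative_mass_nonneg: "0 \<le> negative_mass x"
  by (simp add: negative_mass_def sum_nonneg)

lemma negative_mass_eq_0_iff: "negative_mass x = 0 \<longleftrightarrow> (\<forall>i. 0 \<le> x $ i)"
proof -
  have "max 0 (- a) = 0 \<longleftrightarrow> 0 \<le> a" for a :: real
    by (simp add: max_def)
  then show ?thesis
    unfolding negative_mass_def by (subst sum_nonneg_eq_0_iff) simp_all
qed

lemma negative_mass_scaleR: "0 \<le> c \<Longrightarrow> negative_mass (c *\<^sub>R x) = c * negative_mass x"
  by (simp add: negative_mass_def sum_distrib_left max_mult_distrib_left)

lemma negative_mass_add_le: "negative_mass (x + y) \<le> negative_mass x + negative_mass y"
  unfolding negative_mass_def sum.distrib[symmetric] by (intro sum_mono) auto

lemma uminus_standard_simplex: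
  "uminus ` (standard_simplex :: (real ^ 'n) set) = {x. (\<forall>i. x $ i \<le> 0) \<and> negative_mass x \<le> 1}"
proof -
  have "range (\<lambda>i. axis i 1) = (Basis :: (real ^ 'n) set)"
    by (auto simp: Basis_vec_def)
  then have "(standard_simplex :: (real ^ 'n) set) =
      {x. (\<forall>i\<in>Basis. 0 \<le> x \<bullet> i) \<and> (\<Sum>i\<in>Basis. x \<bullet> i) \<le> 1}"
    by (simp add: standard_simplex_def std_simplex)
  also have "\<dots> = {x. (\<forall>i. 0 \<le> x $ i) \<and> (\<Sum>i\<in>UNIV. x $ i) \<le> 1}"
  proof -
    have "(\<Sum>i\<in>Basis. x \<bullet> i) = (\<Sum>i\<in>UNIV. x $ i)" for x :: "real ^ 'n"
    proof -
      have "inj (\<lambda>i :: 'n. axis i (1 :: real))"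
        by (auto intro!: injI simp: axis_eq_axis)
      then show ?thesis
        by (simp add: \<open>range _ = Basis\<close>[symmetric] sum.reindex inner_axis)
    qed
    moreover have "(\<forall>i\<in>Basis. 0 \<le> x \<bullet> i) \<longleftrightarrow> (\<forall>i. 0 \<le> x $ i)" for x :: "real ^ 'n"
      by (simp add: \<open>range _ = Basis\<close>[symmetric] inner_axis)
    ultimately show ?thesis
      by simp
  qed
  finally have *: "(standard_simplex :: (real ^ 'n) set) = {x. (\<forall>i. 0 \<le> x $ i) \<and> (\<Sum>i\<in>UNIV. x $ i) \<le> 1}" .
  have "x \<in> uminus ` standard_simplex \<longleftrightarrow> - x \<in> standard_simplex" for x :: "real ^ 'n"
    by (metis image_iff minus_minus)
  moreover have "- x \<in> standard_simplex \<longleftrightarrow> (\<forall>i. x $ i \<le> 0) \<and> negative_mass x \<le> 1" for x :: "real ^ 'n"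
    by (auto simp: * negative_mass_def max_def intro!: arg_cong[of _ _ "\<lambda>s. s \<le> 1"] sum.cong)
  ultimately show ?thesis
    by auto
qed

text \<open>The inequalities define a convex set that contains both generating sets. Conversely, for
  0 < s < 1, where s is the sum of the negative parts, a point that satisfies them is the combination
  with weights s and 1 - s of its rescaled negative part, which lies in the reflected simplex, and
  its rescaled positive part, which lies in the box.\<close>

lemma simplex_box_polytope_iff:
  fixes \<theta> :: "'n::finite \<Rightarrow> nat" and x :: "real ^ 'n"
  shows "x \<in> simplex_box_polytope \<theta> \<longleftrightarrow>
    negative_mass x \<le> 1 \<and> (\<forall>i. x $ i \<le> (1 - negative_mass x) * real (\<theta> i))"
proof
  define R where "R = {x :: real ^ 'n. negative_mass x \<le> 1 \<and> (\<forall>i. x $ i \<le> (1 - negative_mass x) * real (\<theta> i))}"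
  have "convex R"
  proof (rule convexI)
    fix x y :: "real ^ 'n" and u v :: real
    assume x: "x \<in> R" and y: "y \<in> R" and uv: "0 \<le> u" "0 \<le> v" "u + v = 1"
    have le: "negative_mass (u *\<^sub>R x + v *\<^sub>R y) \<le> u * negative_mass x + v * negative_mass y"
      using negative_mass_add_le[of "u *\<^sub>R x" "v *\<^sub>R y"] uv by (simp add: negative_mass_scaleR)
    also have "\<dots> \<le> u * 1 + v * 1"
      using x y uv by (intro add_mono mult_left_mono) (auto simp: R_def)
    finally have "negative_mass (u *\<^sub>R x + v *\<^sub>R y) \<le> 1"
      using uv by simp
    moreover have "(u *\<^sub>R x + v *\<^sub>R y) $ i \<le> (1 - negative_mass (u *\<^sub>R x + v *\<^sub>R y)) * real (\<theta> i)" for i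
    proof -
      have "(u *\<^sub>R x + v *\<^sub>R y) $ i \<le>
          u * ((1 - negative_mass x) * real (\<theta> i)) + v * ((1 - negative_mass y) * real (\<theta> i))"
        using x y uv by (auto simp: R_def intro!: add_mono mult_left_mono)
      also have "\<dots> = (u + v - (u * negative_mass x + v * negative_mass y)) * real (\<theta> i)"
        by (simp only: left_diff_distrib distrib_right distrib_left right_diff_distrib mult_1 mult.assoc)
      also have "\<dots> \<le> (1 - negative_mass (u *\<^sub>R x + v *\<^sub>R y)) * real (\<theta> i)"
        by (rule mult_right_mono) (use le uv in linarith, simp)
      finally show ?thesis .
    qed
    ultimately show "u *\<^sub>R x + v *\<^sub>R y \<in> R"
      by (simp add: R_def)
  qed
  moreover have "uminus ` standard_simplex \<subseteq> R"
  proof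
    fix x :: "real ^ 'n" assume "x \<in> uminus ` standard_simplex"
    then have x: "\<And>i. x $ i \<le> 0" "negative_mass x \<le> 1"
      unfolding uminus_standard_simplex by auto
    have "x $ i \<le> (1 - negative_mass x) * real (\<theta> i)" for i
      by (rule order_trans[OF x(1)]) (use x(2) in simp)
    with x(2) show "x \<in> R"
      by (simp add: R_def)
  qed
  moreover have "lattice_box \<theta> \<subseteq> R"
  proof
    fix x :: "real ^ 'n" assume x: "x \<in> lattice_box \<theta>"
    then have "negative_mass x = 0"
      by (simp add: negative_mass_eq_0_iff lattice_box_def)
    with x show "x \<in> R"
      by (simp add: R_def lattice_box_def)
  qed
  ultimately have "simplex_box_polytope \<theta> \<subseteq> R"
    unfolding simplex_box_polytope_def by (intro hull_minimal) auto
  then show "x \<in> simplex_box_polytope \<theta> \<Longrightarrow>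
      negative_mass x \<le> 1 \<and> (\<forall>i. x $ i \<le> (1 - negative_mass x) * real (\<theta> i))"
    by (auto simp: R_def)
next
  assume x: "negative_mass x \<le> 1 \<and> (\<forall>i. x $ i \<le> (1 - negative_mass x) * real (\<theta> i))"
  define s where "s = negative_mass x"
  have s: "0 \<le> s" "s \<le> 1"
    using x by (auto simp: s_def negative_mass_nonneg)
  have simplex: "y \<in> simplex_box_polytope \<theta>" if "\<And>i. y $ i \<le> 0" "negative_mass y \<le> 1" for y :: "real ^ 'n"
    using that unfolding simplex_box_polytope_def
    by (intro hull_inc) (auto simp: uminus_standard_simplex)
  have box: "y \<in> simplex_box_polytope \<theta>" if "y \<in> lattice_box \<theta>" for y :: "real ^ 'n"
    using that unfolding simplex_box_polytope_def by (intro hull_inc) auto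
  \<comment> \<open>For s = 0 and s = 1 one of the two weights, by which the parts are divided, is zero.\<close>
  consider "s = 0" | "s = 1" | "0 < s" "s < 1"
    using s by fastforce
  then show "x \<in> simplex_box_polytope \<theta>"
  proof cases
    case 1
    then show ?thesis
      using x negative_mass_eq_0_iff[of x] by (intro box) (auto simp: s_def lattice_box_def)
  next
    case 2
    then show ?thesis
      using x by (intro simplex) (auto simp: s_def)
  next
    case 3
    define p where "p = (\<chi> i. max 0 (x $ i) / (1 - s))"
    define q where "q = (\<chi> i. min 0 (x $ i) / s)"
    have "(1 / s) * max 0 (- a) = max 0 (- (min 0 a / s))" for a
      using 3 by (simp add: max_def min_def divide_le_0_iff)
    then have "(1 / s) * negative_mass x = negative_mass q"
      unfolding q_def negative_mass_def by (simp add: sum_distrib_left)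
    then have "q \<in> simplex_box_polytope \<theta>"
      using 3 by (intro simplex) (simp_all add: q_def divide_nonpos_pos flip: s_def)
    moreover have "0 \<le> p $ i \<and> p $ i \<le> real (\<theta> i)" for i
      using 3 x by (simp add: p_def pos_divide_le_eq mult.commute flip: s_def)
    then have "p \<in> simplex_box_polytope \<theta>"
      by (intro box) (simp add: lattice_box_def)
    moreover have "convex (simplex_box_polytope \<theta>)"
      by (simp add: simplex_box_polytope_def convex_convex_hull)
    ultimately have "s *\<^sub>R q + (1 - s) *\<^sub>R p \<in> simplex_box_polytope \<theta>"
      using 3 by (simp add: convexD)
    also have "s *\<^sub>R q + (1 - s) *\<^sub>R p = x"
      using 3 by (simp add: vec_eq_iff p_def q_def min_def max_def)
    finally show ?thesis .
  qed
qed

lemma dilated_simplex_box_polytope_iff: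
  fixes \<theta> :: "'n::finite \<Rightarrow> nat" and x :: "real ^ 'n"
  shows "x \<in> (\<lambda>x. real n *\<^sub>R x) ` simplex_box_polytope \<theta> \<longleftrightarrow>
    negative_mass x \<le> real n \<and> (\<forall>i. x $ i \<le> (real n - negative_mass x) * real (\<theta> i))"
proof (cases "n = 0")
  case True
  have "0 \<in> simplex_box_polytope \<theta>"
    by (simp add: simplex_box_polytope_iff negative_mass_def)
  then have image: "(\<lambda>x. real n *\<^sub>R x) ` simplex_box_polytope \<theta> = {0}"
    using True by auto
  have "negative_mass x \<le> 0 \<and> (\<forall>i. x $ i \<le> - (negative_mass x * real (\<theta> i))) \<longleftrightarrow> x = 0"
  proof
    assume R: "negative_mass x \<le> 0 \<and> (\<forall>i. x $ i \<le> - (negative_mass x * real (\<theta> i)))"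
    then have "negative_mass x = 0"
      using negative_mass_nonneg[of x] by linarith
    with R negative_mass_eq_0_iff[of x] show "x = 0"
      by (auto simp: vec_eq_iff intro!: antisym)
  qed (auto simp: negative_mass_def)
  with True show ?thesis
    unfolding image by simp
next
  case False
  have "x \<in> (\<lambda>x. real n *\<^sub>R x) ` simplex_box_polytope \<theta> \<longleftrightarrow>
      (1 / real n) *\<^sub>R x \<in> simplex_box_polytope \<theta>"
  proof
    assume "(1 / real n) *\<^sub>R x \<in> simplex_box_polytope \<theta>"
    then show "x \<in> (\<lambda>x. real n *\<^sub>R x) ` simplex_box_polytope \<theta>"
      by (rule image_eqI[rotated]) (use False in simp)
  qed (use False in auto)
  also have "\<dots> \<longleftrightarrow> negative_mass x / real n \<le> 1 \<and>
      (\<forall>i. x $ i / real n \<le> (1 - negative_mass x / real n) * real (\<theta> i))"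
    by (simp add: simplex_box_polytope_iff negative_mass_scaleR)
  also have "\<dots> \<longleftrightarrow> negative_mass x \<le> real n \<and>
      (\<forall>i. x $ i \<le> (real n - negative_mass x) * real (\<theta> i))"
  proof -
    have "(1 - negative_mass x / real n) * real (\<theta> i) = (real n - negative_mass x) * real (\<theta> i) / real n" for i
      using False by (simp add: field_simps)
    then show ?thesis
      using False by (simp add: divide_le_cancel)
  qed
  finally show ?thesis .
qed

lemma lattice_points_eq_slices:
  fixes \<theta> :: "'n::finite \<Rightarrow> nat"
  shows "(\<lambda>x. real n *\<^sub>R x) ` simplex_box_polytope \<theta> \<inter> integer_lattice =
    (\<lambda>f. (\<chi> i. real_of_int (f i)) :: real ^ 'n) ` (\<Union>m\<le>n. lattice_slice \<theta> UNIV m (n - m))"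
proof -
  have "max 0 (- real_of_int a) = real (nat (- a))" for a
    by (cases "a \<le> 0") simp_all
  then have mass: "negative_mass (\<chi> i. real_of_int (f i)) = real (\<Sum>i\<in>UNIV. nat (- f i))"
    for f :: "'n \<Rightarrow> int"
    unfolding negative_mass_def of_nat_sum by simp
  have slice: "f \<in> (\<Union>m\<le>n. lattice_slice \<theta> UNIV m (n - m)) \<longleftrightarrow>
      s \<le> n \<and> (\<forall>i. f i \<le> int ((n - s) * \<theta> i))"
    if s: "s = (\<Sum>i\<in>UNIV. nat (- f i))" for f s
  proof -
    have "f \<in> lattice_slice \<theta> UNIV m (n - m) \<longleftrightarrow> (\<forall>i. f i \<le> int (m * \<theta> i)) \<and> s = n - m" for m
      unfolding lattice_slice_def s by (simp add: PiE_iff del: of_nat_mult)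
    then have "f \<in> (\<Union>m\<le>n. lattice_slice \<theta> UNIV m (n - m)) \<longleftrightarrow>
        (\<exists>m\<le>n. (\<forall>i. f i \<le> int (m * \<theta> i)) \<and> s = n - m)"
      by blast
    also have "\<dots> \<longleftrightarrow> s \<le> n \<and> (\<forall>i. f i \<le> int ((n - s) * \<theta> i))"
      by (metis diff_diff_cancel diff_le_self)
    finally show ?thesis .
  qed
  have key: "(\<chi> i. real_of_int (f i)) \<in> (\<lambda>x. real n *\<^sub>R x) ` simplex_box_polytope \<theta> \<longleftrightarrow>
      f \<in> (\<Union>m\<le>n. lattice_slice \<theta> UNIV m (n - m))" for f :: "'n \<Rightarrow> int"
  proof -
    define s where "s = (\<Sum>i\<in>UNIV. nat (- f i))"
    have "real_of_int (f i) \<le> (real n - real s) * real (\<theta> i) \<longleftrightarrow> f i \<le> int ((n - s) * \<theta> i)"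
      if "s \<le> n" for i
    proof -
      have "(real n - real s) * real (\<theta> i) = real_of_int (int ((n - s) * \<theta> i))"
        using that by (simp add: of_nat_diff)
      then show ?thesis
        by (simp only: of_int_le_iff)
    qed
    then show ?thesis
      unfolding dilated_simplex_box_polytope_iff slice[OF s_def] mass s_def[symmetric] by auto
  qed
  have lattice: "x \<in> integer_lattice \<longleftrightarrow> (\<exists>f. x = (\<chi> i. real_of_int (f i)))" for x :: "real ^ 'n"
  proof
    assume x: "x \<in> integer_lattice"
    show "\<exists>f. x = (\<chi> i. real_of_int (f i))"
    proof
      show "x = (\<chi> i. real_of_int \<lfloor>x $ i\<rfloor>)"
        using x by (simp add: integer_lattice_def vec_eq_iff)
    qed
  qed (auto simp: integer_lattice_def)
  show ?thesis
  proof (intro equalityI subsetI)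
    fix x :: "real ^ 'n"
    assume x: "x \<in> (\<lambda>x. real n *\<^sub>R x) ` simplex_box_polytope \<theta> \<inter> integer_lattice"
    then obtain f where f: "x = (\<chi> i. real_of_int (f i))"
      using lattice[of x] by (elim IntE) iprover
    show "x \<in> (\<lambda>f. (\<chi> i. real_of_int (f i))) ` (\<Union>m\<le>n. lattice_slice \<theta> UNIV m (n - m))"
      using x key[of f] unfolding f by (intro imageI) (elim IntE, iprover)
  next
    fix x :: "real ^ 'n"
    assume "x \<in> (\<lambda>f. (\<chi> i. real_of_int (f i))) ` (\<Union>m\<le>n. lattice_slice \<theta> UNIV m (n - m))"
    then obtain f where f: "x = (\<chi> i. real_of_int (f i))"
        "f \<in> (\<Union>m\<le>n. lattice_slice \<theta> UNIV m (n - m))"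
      by (rule imageE)
    show "x \<in> (\<lambda>x. real n *\<^sub>R x) ` simplex_box_polytope \<theta> \<inter> integer_lattice"
    proof (rule IntI)
      show "x \<in> (\<lambda>x. real n *\<^sub>R x) ` simplex_box_polytope \<theta>"
        unfolding f(1) by (rule iffD2[OF key f(2)])
      show "x \<in> integer_lattice"
        by (simp add: f(1) integer_lattice_def)
    qed
  qed
qed

lemma card_lattice_points:
  fixes \<theta> :: "'n::finite \<Rightarrow> nat"
  shows "real (card ((\<lambda>x. real n *\<^sub>R x) ` (simplex_box_polytope \<theta> :: (real ^ 'n) set) \<inter> integer_lattice)) =
    fps_nth (fps_of_poly (simplex_box_hstar \<theta>) * geometric_fps ^ Suc CARD('n)) n"
proof -
  have "inj (\<lambda>f. (\<chi> i. real_of_int (f i)) :: real ^ 'n)"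
    by (auto simp: inj_def vec_eq_iff)
  then have "card ((\<lambda>x. real n *\<^sub>R x) ` (simplex_box_polytope \<theta> :: (real ^ 'n) set) \<inter> integer_lattice) =
      card (\<Union>m\<le>n. lattice_slice \<theta> UNIV m (n - m))"
    unfolding lattice_points_eq_slices by (meson card_image inj_on_subset subset_UNIV)
  also have "\<dots> = (\<Sum>m\<le>n. card (lattice_slice \<theta> UNIV m (n - m)))"
  proof (rule card_UN_disjoint)
    show "\<forall>m\<in>{..n}. finite (lattice_slice \<theta> UNIV m (n - m))"
      by (simp add: card_lattice_slice)
    show "\<forall>m\<in>{..n}. \<forall>m'\<in>{..n}. m \<noteq> m' \<longrightarrow>
        lattice_slice \<theta> UNIV m (n - m) \<inter> lattice_slice \<theta> UNIV m' (n - m') = {}"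
      by (auto simp: lattice_slice_def)
  qed simp
  finally show ?thesis
    unfolding simplex_box_hstar_generating_function by (simp add: card_lattice_slice del: of_nat_mult)
qed

section \<open>Identification of the h-star polynomial\<close>

lemma poly_binomial_shift:
  assumes "j \<le> d"
  shows "\<exists>q :: real poly. \<forall>n. poly q (real n) = real ((n + d - j) choose d)"
proof (intro exI allI)
  fix n
  have "real ((n + d - j) choose d) = real (n + d - j) gchoose d"
    by (rule binomial_gbinomial)
  also have "\<dots> = (\<Prod>i = 0..<d. real n + (real d - real j - real i)) / fact d"
    using assms by (simp add: gbinomial_prod_rev of_nat_diff algebra_simps)
  also have "\<dots> = poly (smult (1 / fact d) (\<Prod>i = 0..<d. [:real d - real j - real i, 1:])) (real n)"
    by (simp add: poly_prod add.commute)
  finally show "poly (smult (1 / fact d) (\<Prod>i = 0..<d. [:real d - real j - real i, 1:])) (real n) =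
      real ((n + d - j) choose d)" by simp
qed

lemma poly_eqI_nat:
  fixes p q :: "real poly"
  assumes "\<And>n :: nat. poly p (real n) = poly q (real n)"
  shows "p = q"
proof (rule ccontr)
  assume "p \<noteq> q"
  then have "finite {x. poly (p - q) x = 0}"
    by (intro poly_roots_finite) simp
  moreover have "range real \<subseteq> {x. poly (p - q) x = 0}"
    using assms by auto
  ultimately have "finite (range real)"
    by (rule finite_subset[rotated])
  then show False
    using range_inj_infinite[OF inj_of_nat[where 'a = real]] by simp
qed

text \<open>At the argument n, the terms with j > n vanish and the one with j = n is the n-th
  coefficient, so the coefficients are determined one after the other.\<close>

lemma binomial_basis_unique:
  fixes G H :: "real poly"
  assumes deg: "degree G \<le> d" "degree H \<le> d"
    and eq: "\<And>n. (\<Sum>j\<le>d. coeff G j * real ((n + d - j) choose d)) =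
      (\<Sum>j\<le>d. coeff H j * real ((n + d - j) choose d))"
  shows "G = H"
proof (rule poly_eqI)
  fix n
  show "coeff G n = coeff H n"
  proof (induction n rule: less_induct)
    case (less n)
    show ?case
    proof (cases "n \<le> d")
      case True
      have "0 = (\<Sum>j\<le>d. (coeff G j - coeff H j) * real ((n + d - j) choose d))"
        using eq[of n] by (simp add: left_diff_distrib sum_subtractf)
      also have "\<dots> = (\<Sum>j\<in>{n}. (coeff G j - coeff H j) * real ((n + d - j) choose d))"
        using True less by (intro sum.mono_neutral_right) (auto simp: neq_iff binomial_eq_0)
      finally show ?thesis
        by simp
    qed (use deg in \<open>simp add: coeff_eq_0\<close>)
  qed
qed

lemma hstar_poly_eqI:
  fixes P :: "(real ^ 'n::finite) set"
  assumes deg: "degree H \<le> CARD('n)"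
    and count: "\<And>n. real (card ((\<lambda>x. real n *\<^sub>R x) ` P \<inter> integer_lattice)) =
      fps_nth (fps_of_poly H * geometric_fps ^ Suc CARD('n)) n"
  shows "hstar_poly P = H"
proof -
  let ?d = "CARD('n)"
  have "\<forall>j. \<exists>q :: real poly. j \<le> ?d \<longrightarrow> (\<forall>n. poly q (real n) = real ((n + ?d - j) choose ?d))"
    using poly_binomial_shift[of _ ?d] by blast
  then obtain q :: "nat \<Rightarrow> real poly"
    where q: "\<And>j n. j \<le> ?d \<Longrightarrow> poly (q j) (real n) = real ((n + ?d - j) choose ?d)"
    by metis
  define E where "E = (\<Sum>j\<le>?d. smult (coeff H j) (q j))"
  have E: "poly E (real n) = (\<Sum>j\<le>?d. coeff H j * real ((n + ?d - j) choose ?d))" for n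
    unfolding E_def by (simp add: poly_sum q)
  have ehrhart: "ehrhart_poly P = E"
    unfolding ehrhart_poly_def count
  proof (rule the_equality)
    show "\<forall>n. poly E (real n) = fps_nth (fps_of_poly H * geometric_fps ^ Suc ?d) n"
      unfolding E hstar_generating_function[OF deg] by blast
    fix E' assume "\<forall>n. poly E' (real n) = fps_nth (fps_of_poly H * geometric_fps ^ Suc ?d) n"
    then show "E' = E"
      by (intro poly_eqI_nat) (simp only: E hstar_generating_function[OF deg])
  qed
  show ?thesis
    unfolding hstar_poly_def ehrhart E
  proof (rule the_equality)
    show "degree H \<le> ?d \<and> (\<forall>n. (\<Sum>j\<le>?d. coeff H j * real ((n + ?d - j) choose ?d)) =
        (\<Sum>j\<le>?d. coeff H j * real ((n + ?d - j) choose ?d)))"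
      using deg by blast
    fix H' assume "degree H' \<le> ?d \<and> (\<forall>n. (\<Sum>j\<le>?d. coeff H j * real ((n + ?d - j) choose ?d)) =
        (\<Sum>j\<le>?d. coeff H' j * real ((n + ?d - j) choose ?d)))"
    then show "H' = H"
      using deg by (intro binomial_basis_unique[of H' ?d H]) simp_all
  qed
qed

theorem corollary6p4:
  fixes \<theta> :: "'n::finite \<Rightarrow> nat"
  assumes "\<And>i. \<theta> i > 0"
  shows "unimodal CARD('n) (coeff (hstar_poly (simplex_box_polytope \<theta> :: (real ^ 'n) set)))"
proof -
  have "hstar_poly (simplex_box_polytope \<theta> :: (real ^ 'n) set) = simplex_box_hstar \<theta>"
    by (intro hstar_poly_eqI degree_simplex_box_hstar card_lattice_points)
  with unimodal_simplex_box_hstar[OF assms] show ?thesis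
    by simp
qed

end
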